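(* Let $SA_1\ldots A_n$ be a simplex in $\mathbb R^{n}$ and let $L$ be a $k$-dimensional linear subspace of $\mathbb R^n$ (through $S$), $1\le k\le n-1$, with orthogonal projection $Q$. Then $$\sigma_k^{-}\le\operatorname{tr}(QM)\le\sigma_k^{+}.\qquad( * )$$ Consequently, for real $\lambda$: if $\lambda<\tfrac12$, $$n\lambda^{2}+(1-2\lambda)\sigma_k^{-}\le\sum_{i=1}^{n}\frac{B_iH_i^{2}}{SA_i^{2}}\le n\lambda^{2}+(1-2\lambda)\sigma_k^{+};$$ if $\lambda=\tfrac12$, $$\sum_{i=1}^{n}\frac{B_iH_i^{2}}{SA_i^{2}}=\frac n4;$$ if $\lambda>\tfrac12$, $$n\lambda^{2}+(1-2\lambda)\sigma_k^{+}\le\sum_{i=1}^{n}\frac{B_iH_i^{2}}{SA_i^{2}}\le n\lambda^{2}+(1-2\lambda)\sigma_k^{-}.$$ Equality holds on the right of $( * )$ if and only if $L$ is invariant under $M$ and the eigenvalues of $M|_L$, counted with multiplicity, are $\mu_1,\ldots,\mu_k$; equality holds on the left of $( * )$ if and only if $L$ is invariant under $M$ and the eigenvalues of $M|_L$, counted with multiplicity, are $\mu_{n-k+1},\ldots,\mu_n$. In particular, for every simplex both bounds in $( * )$ are attained (by suitable $k$-dimensional subspaces $L$).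
   Context: $SA_1\ldots A_n$ is a simplex in Euclidean space $\mathbb R^n$ with $S$ identified with the origin, so the edge vectors $\mathbf u_i=\overrightarrow{SA_i}$ are linearly independent. Put $\mathbf e_i=\mathbf u_i/\lVert\mathbf u_i\rVert$ and $M=\sum_{i=1}^n\mathbf e_i\mathbf e_i^{\mathsf T}$, a positive definite matrix with $\operatorname{tr}M=n$ (it has the same spectrum as the Gram matrix $(\langle\mathbf e_i,\mathbf e_j\rangle)_{i,j}$). Let $\mu_1\ge\mu_2\ge\cdots\ge\mu_n>0$ be the eigenvalues of $M$ and put $\sigma_k^{+}=\mu_1+\cdots+\mu_k$, $\sigma_k^{-}=\mu_{n-k+1}+\cdots+\mu_n$. $H_i$ is the orthogonal projection of $A_i$ onto $L$, and $B_i$ is the point with $\overrightarrow{SB_i}=\lambda\mathbf u_i$. For points $X,Y$, $XY$ denotes their Euclidean distance. *)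

theory Defs
  imports "HOL-Analysis.Analysis" "HOL-Library.Multiset"
begin

definition orth_proj :: "'a::euclidean_space set \<Rightarrow> 'a \<Rightarrow> 'a" where
  "orth_proj L x = (THE y. y \<in> L \<and> (\<forall>z\<in>L. orthogonal (x - y) z))"

text \<open>
  Eigenvalues of the restriction to a subspace \<open>V\<close> of a linear map \<open>f\<close>; meaningful when
  \<open>f ` V \<subseteq> V\<close>. The multiplicity is the algebraic one, in its basis-free form as the dimension
  of the generalized eigenspace in \<open>V\<close>.
\<close>

definition eigenvalues_on :: "('a::euclidean_space \<Rightarrow> 'a) \<Rightarrow> 'a set \<Rightarrow> real set" where
  "eigenvalues_on f V = {c. \<exists>v\<in>V. v \<noteq> 0 \<and> f v = c *\<^sub>R v}"

definition eigen_multiplicity_on ::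
    "('a::euclidean_space \<Rightarrow> 'a) \<Rightarrow> 'a set \<Rightarrow> real \<Rightarrow> nat" where
  "eigen_multiplicity_on f V c =
     dim {v \<in> V. \<exists>m. ((\<lambda>w. f w - c *\<^sub>R w) ^^ m) v = 0}"

definition eigenvalue_mset_on ::
    "('a::euclidean_space \<Rightarrow> 'a) \<Rightarrow> 'a set \<Rightarrow> real multiset" where
  "eigenvalue_mset_on f V =
     (\<Sum>c\<in>eigenvalues_on f V. replicate_mset (eigen_multiplicity_on f V c) c)"

text \<open>
  \<open>ordered_eigenvalue M i\<close> is \<open>\<mu>\<^sub>i\<close>, the \<open>i\<close>-th largest eigenvalue, with \<open>i\<close> counted
  from \<open>1\<close>. It is intended for symmetric \<open>M\<close>, where all \<open>CARD('n)\<close> eigenvalues are real.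
\<close>

definition ordered_eigenvalue :: "real ^ 'n ^ 'n \<Rightarrow> nat \<Rightarrow> real" where
  "ordered_eigenvalue M i =
     rev (sorted_list_of_multiset (eigenvalue_mset_on ((*v) M) UNIV)) ! (i - 1)"

definition sigma_plus :: "real ^ 'n ^ 'n \<Rightarrow> nat \<Rightarrow> real" where
  "sigma_plus M k = (\<Sum>i=1..k. ordered_eigenvalue M i)"

definition sigma_minus :: "real ^ 'n ^ 'n \<Rightarrow> nat \<Rightarrow> real" where
  "sigma_minus M k = (\<Sum>i=CARD('n) - k + 1..CARD('n). ordered_eigenvalue M i)"

definition unit_edge :: "('n \<Rightarrow> real ^ 'n) \<Rightarrow> 'n \<Rightarrow> real ^ 'n" where
  "unit_edge A i = A i /\<^sub>R norm (A i)"

definition edge_matrix :: "('n::finite \<Rightarrow> real ^ 'n) \<Rightarrow> real ^ 'n ^ 'n" where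
  "edge_matrix A =
     (\<Sum>i\<in>UNIV. (columnvector (unit_edge A i) :: real ^ 1 ^ 'n) ** rowvector (unit_edge A i))"

text \<open>
  With \<open>S = 0\<close>: \<open>B\<^sub>i = \<lambda> A\<^sub>i\<close>, and \<open>H\<^sub>i\<close> is the projection of \<open>A\<^sub>i\<close> onto \<open>L\<close>.
\<close>

definition ratio_sum :: "('n::finite \<Rightarrow> real ^ 'n) \<Rightarrow> (real ^ 'n) set \<Rightarrow> real \<Rightarrow> real" where
  "ratio_sum A L l =
     (\<Sum>i\<in>UNIV. (dist (l *\<^sub>R A i) (orth_proj L (A i)))\<^sup>2 / (dist 0 (A i))\<^sup>2)"

end

theory Submission
  imports Defs
begin

text \<open>
  Choose an orthonormal basis \<open>C\<close> of \<open>L\<close>. Then \<open>tr (QM)\<close> is the sum of the Rayleigh values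
  \<open>Mc \<bullet> c\<close> over \<open>C\<close>, so \<open>(*)\<close> is Ky Fan's principle for the self-adjoint map \<open>M\<close>. To see why it
  holds, take an orthonormal eigenbasis \<open>B\<close> of the whole space. With \<open>\<mu>\<^sub>b\<close> the eigenvalue of \<open>b\<close>,
  the trace becomes \<open>\<Sum>b\<in>B. \<mu>\<^sub>b * p\<^sub>b\<close>, where the weight \<open>p\<^sub>b = b \<bullet> Q b\<close> lies in \<open>[0, 1]\<close> and the
  weights add up to \<open>k = dim L\<close>. If \<open>T\<close> consists of \<open>k\<close> basis vectors whose eigenvalues are at least
  \<open>t\<close>, while the others have eigenvalue at most \<open>t\<close>, then (lemma \<open>ky_fan_gap\<close>)
  \<open>(\<Sum>b\<in>T. \<mu>\<^sub>b) - tr (QM) = (\<Sum>b\<in>T. (\<mu>\<^sub>b - t) * (1 - p\<^sub>b)) + (\<Sum>b\<in>B - T. (t - \<mu>\<^sub>b) * p\<^sub>b)\<close>,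
  and every term on the right is nonnegative.

  Equality forces every term to vanish: \<open>L\<close> contains the eigenvectors with \<open>\<mu>\<^sub>b > t\<close> and is orthogonal
  to those with \<open>\<mu>\<^sub>b < t\<close>. On \<open>L\<close> the map therefore differs from \<open>t\<close> times the identity only by
  components along vectors of \<open>L\<close>, which makes \<open>L\<close> invariant; and an eigenbasis of \<open>L\<close> that extends
  \<open>{b\<in>B. \<mu>\<^sub>b > t}\<close> can only add the eigenvalue \<open>t\<close>, so its eigenvalues are those of \<open>T\<close>. Conversely
  the trace over an invariant \<open>L\<close> is the sum of its eigenvalues. The lower bound is the upper bound for
  \<open>-M\<close>, and the spans of suitable \<open>k\<close>-element subsets of \<open>B\<close> attain the bounds.

  The ratio sum is affine in the trace: with \<open>e\<^sub>i\<close> the unit edges,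
  \<open>\<bar>\<lambda> e\<^sub>i - Q e\<^sub>i\<bar>\<^sup>2 = \<lambda>\<^sup>2 + (1 - 2 \<lambda>) (e\<^sub>i \<bullet> Q e\<^sub>i)\<close>, and the last factors add up to \<open>tr (QM)\<close>.
  The sign of \<open>1 - 2 \<lambda>\<close> decides which way round the bounds of \<open>(*)\<close> carry over.
\<close>

section \<open>Orthonormal sets and orthogonal projection\<close>

definition orthonormal_set :: "'a::euclidean_space set \<Rightarrow> bool" where
  "orthonormal_set C \<longleftrightarrow> pairwise orthogonal C \<and> (\<forall>c\<in>C. norm c = 1)"

lemma orthonormal_set_inner:
  assumes "orthonormal_set C" "c \<in> C" "d \<in> C"
  shows "c \<bullet> d = (if c = d then 1 else 0)"
  using assms
  by (auto simp: orthonormal_set_def pairwise_def orthogonal_def norm_eq_1)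

lemma orthonormal_set_finite: "orthonormal_set C \<Longrightarrow> finite C"
  by (simp add: orthonormal_set_def pairwise_orthogonal_imp_finite)

lemma orthonormal_set_independent: "orthonormal_set C \<Longrightarrow> independent C"
  by (rule pairwise_orthogonal_independent) (auto simp: orthonormal_set_def)

lemma orthonormal_set_subset: "orthonormal_set C \<Longrightarrow> D \<subseteq> C \<Longrightarrow> orthonormal_set D"
  by (auto simp: orthonormal_set_def pairwise_def)

lemma orthonormal_set_card: "orthonormal_set C \<Longrightarrow> card C = dim (span C)"
  by (simp add: orthonormal_set_independent dim_eq_card_independent)

lemma inner_sum_orthonormal:
  assumes "orthonormal_set C" "d \<in> C"
  shows "(\<Sum>c\<in>C. a c *\<^sub>R c) \<bullet> d = a d"
proof -
  have "(\<Sum>c\<in>C. a c *\<^sub>R c) \<bullet> d = (\<Sum>c\<in>C. if c = d then a d else 0)"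
    unfolding inner_sum_left using assms
    by (intro sum.cong) (auto simp: orthonormal_set_inner)
  also have "\<dots> = a d"
    using assms by (simp add: orthonormal_set_finite)
  finally show ?thesis .
qed

text \<open>
  The difference between a vector and its Fourier sum is orthogonal to the span: this makes the Fourier sum
  the orthogonal projection.
\<close>
lemma orthonormal_residual:
  assumes "orthonormal_set C" "z \<in> span C"
  shows "(x - (\<Sum>c\<in>C. (x \<bullet> c) *\<^sub>R c)) \<bullet> z = 0"
proof -
  have "orthogonal (x - (\<Sum>c\<in>C. (x \<bullet> c) *\<^sub>R c)) z"
    by (rule orthogonal_to_span[OF assms(2)])
       (simp add: orthogonal_def inner_diff_left inner_sum_orthonormal[OF assms(1)])
  then show ?thesis by (simp add: orthogonal_def)
qed

lemma orthonormal_expansion: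
  assumes "orthonormal_set C" "x \<in> span C"
  shows "(\<Sum>c\<in>C. (x \<bullet> c) *\<^sub>R c) = x"
proof -
  let ?r = "x - (\<Sum>c\<in>C. (x \<bullet> c) *\<^sub>R c)"
  have "?r \<in> span C"
    by (rule span_diff[OF assms(2)]) (intro span_sum span_scale span_base)
  from orthonormal_residual[OF assms(1) this, of x] show ?thesis by simp
qed

lemma parseval:
  assumes "orthonormal_set C" "x \<in> span C"
  shows "x \<bullet> y = (\<Sum>c\<in>C. (x \<bullet> c) * (y \<bullet> c))"
proof -
  have "x \<bullet> y = (\<Sum>c\<in>C. (x \<bullet> c) *\<^sub>R c) \<bullet> y"
    by (simp only: orthonormal_expansion[OF assms])
  then show ?thesis by (simp add: inner_sum_left inner_commute[of y])
qed

text \<open>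
  Bessel's inequality together with its defect, the squared distance from the span: it is nonnegative, and
  zero only in the span.
\<close>
lemma bessel:
  assumes "orthonormal_set C"
  shows "x \<bullet> x - (\<Sum>c\<in>C. (x \<bullet> c)\<^sup>2) =
    (x - (\<Sum>c\<in>C. (x \<bullet> c) *\<^sub>R c)) \<bullet> (x - (\<Sum>c\<in>C. (x \<bullet> c) *\<^sub>R c))"
proof -
  let ?q = "\<Sum>c\<in>C. (x \<bullet> c) *\<^sub>R c"
  have "(x - ?q) \<bullet> ?q = 0"
    by (rule orthonormal_residual[OF assms]) (intro span_sum span_scale span_base)
  moreover have "x \<bullet> ?q = (\<Sum>c\<in>C. (x \<bullet> c)\<^sup>2)"
    by (simp add: inner_sum_right power2_eq_square)
  ultimately show ?thesis
    by (simp add: inner_diff_left inner_diff_right inner_commute)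
qed

lemma orth_proj_span_orthonormal:
  assumes "orthonormal_set C"
  shows "orth_proj (span C) x = (\<Sum>c\<in>C. (x \<bullet> c) *\<^sub>R c)"
  unfolding orth_proj_def
proof (rule the_equality)
  let ?q = "\<Sum>c\<in>C. (x \<bullet> c) *\<^sub>R c"
  have q: "?q \<in> span C" by (intro span_sum span_scale span_base)
  then show "?q \<in> span C \<and> (\<forall>z\<in>span C. orthogonal (x - ?q) z)"
    by (simp add: orthogonal_def orthonormal_residual[OF assms])
  fix y assume y: "y \<in> span C \<and> (\<forall>z\<in>span C. orthogonal (x - y) z)"
  then have d: "y - ?q \<in> span C" using q by (simp add: span_diff)
  then have "(x - y) \<bullet> (y - ?q) = 0" "(x - ?q) \<bullet> (y - ?q) = 0"
    using y orthonormal_residual[OF assms] by (auto simp: orthogonal_def)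
  then have "(y - ?q) \<bullet> (y - ?q) = 0"
    by (simp add: inner_diff_left)
  then show "y = ?q" by simp
qed

section \<open>Eigenbases of self-adjoint maps\<close>

text \<open>
  The eigenvalue of a unit eigenvector is its Rayleigh value, so it need not be carried along separately.
\<close>
definition eigenvectors :: "('a::euclidean_space \<Rightarrow> 'a) \<Rightarrow> 'a set \<Rightarrow> bool" where
  "eigenvectors f C \<longleftrightarrow> (\<forall>c\<in>C. f c = (f c \<bullet> c) *\<^sub>R c)"

text \<open>
  The first-order condition at a maximum: for small \<open>s\<close> of the sign of \<open>a\<close> the
  linear term would win.
\<close>
lemma linear_term_zero:
  fixes a K :: real
  assumes "\<And>s. 2 * s * a \<le> s\<^sup>2 * K"
  shows "a = 0"
proof (rule ccontr)
  assume a: "a \<noteq> 0"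
  \<comment> \<open>The maximizer of \<open>2 s a - s\<^sup>2 (\<bar>K\<bar> + 1)\<close>; adding \<open>1\<close> keeps the denominator positive.\<close>
  define s where "s = a / (\<bar>K\<bar> + 1)"
  have "a = s * (\<bar>K\<bar> + 1)" by (simp add: s_def)
  then have "2 * s * a = 2 * ((\<bar>K\<bar> + 1) * s\<^sup>2)"
    by (simp add: power2_eq_square)
  moreover have "s\<^sup>2 * K \<le> (\<bar>K\<bar> + 1) * s\<^sup>2"
    by (subst mult.commute) (intro mult_right_mono; simp)
  moreover have "(\<bar>K\<bar> + 1) * s\<^sup>2 > 0" using a by (simp add: s_def add_nonneg_pos)
  ultimately show False using assms[of s] by linarith
qed

text \<open>
  A maximizer \<open>v\<close> of \<open>f x \<bullet> x\<close> on the unit sphere of \<open>V\<close>,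
  with value \<open>t\<close>, is an eigenvector. Indeed \<open>w = f v - t v\<close> is orthogonal to
  \<open>v\<close>; perturbing \<open>v\<close> in the direction \<open>w\<close> shows
  \<open>f v \<bullet> w = 0\<close>, and this inner product is \<open>w \<bullet> w\<close>.
\<close>
lemma exists_unit_eigenvector:
  fixes f :: "'a::euclidean_space \<Rightarrow> 'a"
  assumes "linear f" "subspace V" "f ` V \<subseteq> V" "V \<noteq> {0}"
    and sym: "\<And>x y. f x \<bullet> y = x \<bullet> f y"
  shows "\<exists>v\<in>V. norm v = 1 \<and> f v = (f v \<bullet> v) *\<^sub>R v"
proof -
  let ?S = "V \<inter> sphere 0 1"
  obtain u where u: "u \<in> V" "u \<noteq> 0"
    using assms(2,4) subspace_0 by blast
  then have "u /\<^sub>R norm u \<in> ?S"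
    using assms(2) by (simp add: subspace_scale)
  moreover have "compact ?S"
    by (intro closed_Int_compact closed_subspace assms compact_sphere)
  moreover have "continuous_on ?S (\<lambda>x. f x \<bullet> x)"
    by (intro continuous_intros linear_continuous_on linear_linear[THEN iffD2] assms)
  ultimately obtain v where v: "v \<in> ?S" and max: "\<And>x. x \<in> ?S \<Longrightarrow> f x \<bullet> x \<le> f v \<bullet> v"
    using continuous_attains_sup[of ?S "\<lambda>x. f x \<bullet> x"] by blast
  let ?t = "f v \<bullet> v"
  have vv: "v \<bullet> v = 1" using v by (simp add: norm_eq_1)
  have le: "f x \<bullet> x \<le> ?t * (x \<bullet> x)" if "x \<in> V" for x
  proof (cases "x = 0")
    case False
    then have "x /\<^sub>R norm x \<in> ?S" using that assms(2) by (simp add: subspace_scale)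
    from max[OF this] False show ?thesis
      by (simp add: linear_cmul[OF assms(1)] field_simps dot_square_norm power2_eq_square)
  qed (simp add: linear_0[OF assms(1)])
  define w where "w = f v - ?t *\<^sub>R v"
  have wV: "w \<in> V"
    using v assms(2,3) by (auto simp: w_def intro!: subspace_diff subspace_scale)
  have wv: "v \<bullet> w = 0"
    by (simp add: w_def inner_diff_right vv inner_commute)
  have "f v \<bullet> w = 0"
  proof (rule linear_term_zero)
    fix s :: real
    have "v + s *\<^sub>R w \<in> V" using v wV assms(2) by (simp add: subspace_add subspace_scale)
    from le[OF this] have "(f v + s *\<^sub>R f w) \<bullet> (v + s *\<^sub>R w) \<le> ?t * ((v + s *\<^sub>R w) \<bullet> (v + s *\<^sub>R w))"
      by (simp add: linear_add[OF assms(1)] linear_cmul[OF assms(1)])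
    moreover have "f w \<bullet> v = f v \<bullet> w" using sym[of w v] by (simp add: inner_commute)
    ultimately show "2 * s * (f v \<bullet> w) \<le> s\<^sup>2 * (?t * (w \<bullet> w) - f w \<bullet> w)"
      using wv vv by (simp add: inner_add_left inner_add_right inner_commute algebra_simps power2_eq_square)
  qed
  moreover have "f v \<bullet> w = w \<bullet> w"
    using wv by (simp add: w_def inner_diff_left inner_commute)
  ultimately have "f v = ?t *\<^sub>R v" by (simp add: w_def)
  with v show ?thesis by auto
qed

text \<open>
  The spectral theorem on an invariant subspace, with a prescribed part \<open>D\<close> of the eigenbasis.
  Among the orthonormal sets of eigenvectors between \<open>D\<close> and \<open>V\<close> take one of
  largest cardinality: the part of \<open>V\<close> orthogonal to it is invariant, and a unit eigenvector
  there would enlarge the set. The prescribed part is what lets the equality case of Ky Fan's principle keep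
  the eigenvectors already known to lie in \<open>L\<close>.
\<close>
theorem orthonormal_eigenvectors_extend:
  fixes f :: "'a::euclidean_space \<Rightarrow> 'a"
  assumes "linear f" "subspace V" "f ` V \<subseteq> V"
    and sym: "\<And>x y. f x \<bullet> y = x \<bullet> f y"
    and D: "orthonormal_set D" "eigenvectors f D" "D \<subseteq> V"
  shows "\<exists>C. D \<subseteq> C \<and> orthonormal_set C \<and> eigenvectors f C \<and> span C = V"
proof -
  let ?P = "\<lambda>C. D \<subseteq> C \<and> orthonormal_set C \<and> eigenvectors f C \<and> C \<subseteq> V"
  have "card C < Suc (DIM('a))" if "?P C" for C
    using that orthonormal_set_card[of C] dim_subset_UNIV[of "span C"] by simp
  then obtain C where C: "?P C" and max: "\<And>C'. ?P C' \<Longrightarrow> card C' \<le> card C"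
    using ex_has_greatest_nat[of ?P D card "Suc (DIM('a))"] D by blast
  define W where "W = {x \<in> V. \<forall>c\<in>C. x \<bullet> c = 0}"
  have W: "subspace W"
    using assms(2) by (auto simp: W_def subspace_def inner_add_left)
  have inv: "f ` W \<subseteq> W"
  proof safe
    fix x assume x: "x \<in> W"
    have "f x \<bullet> c = 0" if "c \<in> C" for c
    proof -
      have "f c = (f c \<bullet> c) *\<^sub>R c" using C that by (auto simp: eigenvectors_def)
      then have "x \<bullet> f c = (f c \<bullet> c) * (x \<bullet> c)" by (metis inner_scaleR_right)
      then show ?thesis using x that by (simp add: W_def sym)
    qed
    then show "f x \<in> W" using x assms(3) by (auto simp: W_def)
  qed
  have "W = {0}"
  proof (rule ccontr)
    assume "W \<noteq> {0}"
    from exists_unit_eigenvector[OF assms(1) W inv this sym]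
    obtain v where v: "v \<in> W" "norm v = 1" "f v = (f v \<bullet> v) *\<^sub>R v" by blast
    have "v \<notin> C" using v by (auto simp: W_def norm_eq_1)
    moreover have "?P (insert v C)"
      using C v by (auto simp: W_def orthonormal_set_def eigenvectors_def pairwise_insert
          orthogonal_def inner_commute)
    ultimately show False
      using max[of "insert v C"] C orthonormal_set_finite by force
  qed
  have "x \<in> span C" if "x \<in> V" for x
  proof -
    let ?q = "\<Sum>c\<in>C. (x \<bullet> c) *\<^sub>R c"
    have q: "?q \<in> span C" by (intro span_sum span_scale span_base)
    moreover have "span C \<subseteq> V" using C assms(2) by (simp add: span_minimal)
    ultimately have "x - ?q \<in> W" using that C assms(2) orthonormal_residual[of C _ x]
      by (auto simp: W_def span_base intro!: subspace_diff)
    then show ?thesis using q \<open>W = {0}\<close> by auto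
  qed
  then have "span C = V" using C assms(2) span_minimal by blast
  with C show ?thesis by blast
qed

lemma eigenvectors_expansion:
  assumes "linear f" "orthonormal_set C" "eigenvectors f C" "x \<in> span C"
  shows "f x = (\<Sum>c\<in>C. (f c \<bullet> c * (x \<bullet> c)) *\<^sub>R c)"
proof -
  have "f x = f (\<Sum>c\<in>C. (x \<bullet> c) *\<^sub>R c)" by (simp only: orthonormal_expansion[OF assms(2,4)])
  also have "\<dots> = (\<Sum>c\<in>C. (x \<bullet> c) *\<^sub>R f c)"
    by (simp add: linear_sum[OF assms(1)] linear_cmul[OF assms(1)])
  also have "\<dots> = (\<Sum>c\<in>C. (f c \<bullet> c * (x \<bullet> c)) *\<^sub>R c)"
  proof (rule sum.cong)
    fix c assume "c \<in> C"
    then have "f c = (f c \<bullet> c) *\<^sub>R c" using assms(3) by (simp add: eigenvectors_def)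
    then show "(x \<bullet> c) *\<^sub>R f c = (f c \<bullet> c * (x \<bullet> c)) *\<^sub>R c"
      by (metis scaleR_scaleR mult.commute)
  qed simp
  finally show ?thesis .
qed

lemma eigenvectors_expansion_coefficient:
  assumes "linear f" "orthonormal_set C" "eigenvectors f C" "x \<in> span C" "c \<in> C"
  shows "f x \<bullet> c = (f c \<bullet> c) * (x \<bullet> c)"
  by (simp only: eigenvectors_expansion[OF assms(1-4)] inner_sum_orthonormal[OF assms(2,5)])

lemma eigenvalues_on_eigenbasis:
  assumes "linear f" "orthonormal_set C" "eigenvectors f C"
  shows "eigenvalues_on f (span C) = (\<lambda>c. f c \<bullet> c) ` C"
proof (intro equalityI subsetI)
  fix t assume "t \<in> eigenvalues_on f (span C)"
  then obtain v where v: "v \<in> span C" "v \<noteq> 0" "f v = t *\<^sub>R v"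
    by (auto simp: eigenvalues_on_def)
  have "\<exists>c\<in>C. v \<bullet> c \<noteq> 0"
  proof (rule ccontr)
    assume "\<not> (\<exists>c\<in>C. v \<bullet> c \<noteq> 0)"
    then have "(\<Sum>c\<in>C. (v \<bullet> c) *\<^sub>R c) = 0" by simp
    with v(2) show False by (simp only: orthonormal_expansion[OF assms(2) v(1)])
  qed
  then obtain c where c: "c \<in> C" "v \<bullet> c \<noteq> 0" by blast
  then have "f c \<bullet> c = t"
    using eigenvectors_expansion_coefficient[OF assms v(1) c(1)] v(3) by simp
  then show "t \<in> (\<lambda>c. f c \<bullet> c) ` C" using c by auto
next
  fix t assume "t \<in> (\<lambda>c. f c \<bullet> c) ` C"
  then obtain c where c: "c \<in> C" "t = f c \<bullet> c" by blast
  then have "f c = t *\<^sub>R c" using assms(3) by (metis eigenvectors_def)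
  moreover have "c \<noteq> 0" using assms(2) c by (auto simp: orthonormal_set_def)
  ultimately show "t \<in> eigenvalues_on f (span C)"
    using c span_base by (auto simp: eigenvalues_on_def)
qed

text \<open>
  In an eigenbasis \<open>f - t\<close> acts diagonally with entries \<open>\<mu>\<^sub>c - t\<close>.
  Powers of a nonzero entry stay nonzero, so the generalized eigenspace is no larger than the span of the
  basis vectors with eigenvalue \<open>t\<close>.
\<close>
lemma eigen_multiplicity_on_eigenbasis:
  assumes "linear f" "orthonormal_set C" "eigenvectors f C"
  shows "eigen_multiplicity_on f (span C) t = card {c\<in>C. f c \<bullet> c = t}"
proof -
  let ?D = "{c\<in>C. f c \<bullet> c = t}"
  let ?g = "\<lambda>w. f w - t *\<^sub>R w"
  let ?N = "{v \<in> span C. \<exists>m. (?g ^^ m) v = 0}"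
  have D: "orthonormal_set ?D" by (rule orthonormal_set_subset[OF assms(2)]) auto
  have pow: "(?g ^^ m) v \<in> span C \<and> (\<forall>c\<in>C. (?g ^^ m) v \<bullet> c = (f c \<bullet> c - t) ^ m * (v \<bullet> c))"
    if v: "v \<in> span C" for v m
  proof (induction m)
    case (Suc m)
    let ?w = "(?g ^^ m) v"
    have w: "?w \<in> span C" using Suc by simp
    have "f ?w \<in> span C"
      unfolding eigenvectors_expansion[OF assms w] by (intro span_sum span_scale span_base)
    then have "?g ?w \<in> span C" using w by (simp add: span_diff span_scale)
    moreover have "?g ?w \<bullet> c = (f c \<bullet> c - t) ^ Suc m * (v \<bullet> c)" if "c \<in> C" for c
      using Suc that
      by (simp add: inner_diff_left eigenvectors_expansion_coefficient[OF assms w that] algebra_simps)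
    ultimately show ?case by simp
  qed (use v in simp)
  have "?N = span ?D"
  proof (intro equalityI subsetI)
    fix v assume "v \<in> ?N"
    then obtain m where v: "v \<in> span C" "(?g ^^ m) v = 0" by auto
    have "(f c \<bullet> c - t) ^ m * (v \<bullet> c) = 0" if "c \<in> C" for c
      using pow[OF v(1), of m] v(2) that by (metis inner_zero_left)
    then have cases: "f c \<bullet> c = t \<or> v \<bullet> c = 0" if "c \<in> C" for c
      using that by fastforce
    have "(v \<bullet> c) *\<^sub>R c \<in> span ?D" if "c \<in> C" for c
    proof (cases "f c \<bullet> c = t")
      case True
      then show ?thesis using that by (intro span_scale span_base) simp
    qed (use that cases[OF that] in \<open>simp add: span_zero\<close>)
    then have "(\<Sum>c\<in>C. (v \<bullet> c) *\<^sub>R c) \<in> span ?D" by (rule span_sum)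
    then show "v \<in> span ?D" by (simp only: orthonormal_expansion[OF assms(2) v(1)])
  next
    fix v assume v: "v \<in> span ?D"
    then have vC: "v \<in> span C" using span_mono[of ?D C] by auto
    have "f v = (\<Sum>c\<in>?D. (f c \<bullet> c * (v \<bullet> c)) *\<^sub>R c)"
      using assms v D by (intro eigenvectors_expansion) (auto simp: eigenvectors_def)
    also have "\<dots> = t *\<^sub>R (\<Sum>c\<in>?D. (v \<bullet> c) *\<^sub>R c)"
      unfolding scaleR_sum_right by (rule sum.cong) auto
    finally have "f v = t *\<^sub>R v" by (simp only: orthonormal_expansion[OF D v])
    \<comment> \<open>The first power already annihilates the vector: generalized eigenvectors are eigenvectors.\<close>
    then have "(?g ^^ 1) v = 0" by simp
    then show "v \<in> ?N" using vC by blast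
  qed
  then show ?thesis
    unfolding eigen_multiplicity_on_def using orthonormal_set_card[OF D] by simp
qed

text \<open>
  Any eigenbasis computes the eigenvalues with multiplicity, so all further statements on them can be
  phrased with Rayleigh values.
\<close>
theorem eigenvalue_mset_on_eigenbasis:
  assumes "linear f" "orthonormal_set C" "eigenvectors f C"
  shows "eigenvalue_mset_on f (span C) = image_mset (\<lambda>c. f c \<bullet> c) (mset_set C)"
proof (rule multiset_eqI)
  fix t
  have fin: "finite C" using assms(2) by (rule orthonormal_set_finite)
  have "count (eigenvalue_mset_on f (span C)) t
      = (\<Sum>s\<in>(\<lambda>c. f c \<bullet> c) ` C. if t = s then card {c\<in>C. f c \<bullet> c = s} else 0)"
    by (simp add: eigenvalue_mset_on_def count_sum eigenvalues_on_eigenbasis[OF assms]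
        eigen_multiplicity_on_eigenbasis[OF assms] cong: if_cong)
  also have "\<dots> = card {c\<in>C. f c \<bullet> c = t}"
    using fin by (auto intro!: card_eq_0_iff[THEN iffD2, symmetric])
  also have "\<dots> = count (image_mset (\<lambda>c. f c \<bullet> c) (mset_set C)) t"
    using fin by (simp add: count_image_mset Int_def vimage_def conj_commute)
  finally show "count (eigenvalue_mset_on f (span C)) t
    = count (image_mset (\<lambda>c. f c \<bullet> c) (mset_set C)) t" .
qed

section \<open>Ky Fan's principle and its equality case\<close>

lemma inner_orth_proj_span_orthonormal:
  assumes "orthonormal_set C"
  shows "x \<bullet> orth_proj (span C) x = (\<Sum>c\<in>C. (x \<bullet> c)\<^sup>2)"
  by (simp add: orth_proj_span_orthonormal[OF assms] inner_sum_right power2_eq_square)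

text \<open>
  Equality in Bessel's inequality: a unit vector with weight one has no residual.
\<close>
lemma orthonormal_one_if_in_span:
  assumes "orthonormal_set C" "norm x = 1" "(\<Sum>c\<in>C. (x \<bullet> c)\<^sup>2) = 1"
  shows "x \<in> span C"
proof -
  have "(x - (\<Sum>c\<in>C. (x \<bullet> c) *\<^sub>R c)) \<bullet> (x - (\<Sum>c\<in>C. (x \<bullet> c) *\<^sub>R c)) = 0"
    using bessel[OF assms(1), of x] assms(2,3) by (simp add: norm_eq_1)
  then have "x = (\<Sum>c\<in>C. (x \<bullet> c) *\<^sub>R c)" by simp
  also have "\<dots> \<in> span C" by (intro span_sum span_scale span_base)
  finally show ?thesis .
qed

locale orthonormal_eigenbasis =
  fixes f :: "'a::euclidean_space \<Rightarrow> 'a" and B :: "'a set"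
  assumes lin: "linear f"
    and self_adjoint: "f x \<bullet> y = x \<bullet> f y"
    and orthonormal: "orthonormal_set B"
    and eigenvectors: "eigenvectors f B"
    and span_B: "span B = UNIV"
begin

lemma finite_B: "finite B"
  using orthonormal by (rule orthonormal_set_finite)

text \<open>This reduces minimization to maximization.\<close>
lemma negated: "orthonormal_eigenbasis (\<lambda>x. - f x) B"
proof (rule orthonormal_eigenbasis.intro)
  show "linear (\<lambda>x. - f x)" by (rule linear_compose_neg[OF lin])
  show "- f x \<bullet> y = x \<bullet> - f y" for x y by (simp add: self_adjoint)
  show "eigenvectors (\<lambda>x. - f x) B"
    unfolding eigenvectors_def
  proof
    fix b assume "b \<in> B"
    then have "f b = (f b \<bullet> b) *\<^sub>R b" using eigenvectors by (simp add: eigenvectors_def)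
    then have "- f b = - ((f b \<bullet> b) *\<^sub>R b)" by (rule arg_cong)
    then show "- f b = (- f b \<bullet> b) *\<^sub>R b" by simp
  qed
qed (use orthonormal span_B in auto)

lemma expansion: "f x = (\<Sum>b\<in>B. (f b \<bullet> b * (x \<bullet> b)) *\<^sub>R b)"
  by (rule eigenvectors_expansion[OF lin orthonormal eigenvectors]) (simp add: span_B)

text \<open>
  Subtracting the threshold \<open>t\<close> leaves only the components along eigenvectors with a different
  eigenvalue, which are the ones that the equality case controls.
\<close>
lemma shifted_expansion: "f x = t *\<^sub>R x + (\<Sum>b\<in>B. ((f b \<bullet> b - t) * (x \<bullet> b)) *\<^sub>R b)"
proof -
  have "t *\<^sub>R x = (\<Sum>b\<in>B. (t * (x \<bullet> b)) *\<^sub>R b)"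
    using orthonormal_expansion[OF orthonormal, of x] span_B
    by (simp flip: scaleR_scaleR scaleR_sum_right)
  then show ?thesis
    by (subst expansion) (simp add: algebra_simps sum.distrib sum_subtractf)
qed

text \<open>
  The right-hand side depends on \<open>C\<close> only through its span, so the sum of Rayleigh values is
  the same for all orthonormal bases of a subspace.
\<close>
lemma rayleigh_sum:
  assumes C: "orthonormal_set C"
  shows "(\<Sum>c\<in>C. f c \<bullet> c) = (\<Sum>b\<in>B. (f b \<bullet> b) * (b \<bullet> orth_proj (span C) b))"
proof -
  have "(\<Sum>c\<in>C. f c \<bullet> c) = (\<Sum>c\<in>C. \<Sum>b\<in>B. (f b \<bullet> b) * (b \<bullet> c)\<^sup>2)"
  proof (rule sum.cong)
    fix c
    have "f c \<bullet> c = (\<Sum>b\<in>B. (f b \<bullet> b * (c \<bullet> b)) *\<^sub>R b) \<bullet> c"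
      by (rule arg_cong[where f = "\<lambda>v. v \<bullet> c"]) (rule expansion)
    also have "\<dots> = (\<Sum>b\<in>B. (f b \<bullet> b) * (b \<bullet> c)\<^sup>2)"
      by (simp add: inner_sum_left power2_eq_square inner_commute[of c] mult.assoc)
    finally show "f c \<bullet> c = (\<Sum>b\<in>B. (f b \<bullet> b) * (b \<bullet> c)\<^sup>2)" .
  qed simp
  also have "\<dots> = (\<Sum>b\<in>B. (f b \<bullet> b) * (b \<bullet> orth_proj (span C) b))"
    by (subst sum.swap) (simp add: inner_orth_proj_span_orthonormal[OF C] sum_distrib_left)
  finally show ?thesis .
qed

text \<open>
  These weights are the diagonal entries of the projection in the basis \<open>B\<close>, so this is the
  fact that the trace of a projection is its rank.
\<close>
lemma sum_weights:
  assumes C: "orthonormal_set C"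
  shows "(\<Sum>b\<in>B. b \<bullet> orth_proj (span C) b) = real (card C)"
proof -
  have "(\<Sum>b\<in>B. b \<bullet> orth_proj (span C) b) = (\<Sum>c\<in>C. \<Sum>b\<in>B. (b \<bullet> c)\<^sup>2)"
    by (subst sum.swap) (simp add: inner_orth_proj_span_orthonormal[OF C])
  also have "\<dots> = (\<Sum>c\<in>C. 1)"
  proof (rule sum.cong)
    fix c assume c: "c \<in> C"
    have "(\<Sum>b\<in>B. (b \<bullet> c)\<^sup>2) = c \<bullet> c"
      by (subst parseval[OF orthonormal]) (auto simp: span_B power2_eq_square inner_commute)
    then show "(\<Sum>b\<in>B. (b \<bullet> c)\<^sup>2) = 1"
      using orthonormal_set_inner[OF C c c] by simp
  qed simp
  finally show ?thesis by simp
qed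

lemma weight_bounds:
  assumes C: "orthonormal_set C" and b: "b \<in> B"
  shows "0 \<le> b \<bullet> orth_proj (span C) b" "b \<bullet> orth_proj (span C) b \<le> 1"
proof -
  show "0 \<le> b \<bullet> orth_proj (span C) b"
    by (simp add: inner_orth_proj_span_orthonormal[OF C] sum_nonneg)
  have "0 \<le> b \<bullet> b - b \<bullet> orth_proj (span C) b"
    unfolding inner_orth_proj_span_orthonormal[OF C] bessel[OF C] by simp
  then show "b \<bullet> orth_proj (span C) b \<le> 1"
    using orthonormal_set_inner[OF orthonormal b b] by simp
qed

text \<open>
  Holds for every real \<open>t\<close>: its coefficient is \<open>- card T\<close> plus the sum of all
  weights, which is zero. A threshold between the eigenvalues in \<open>T\<close> and the others makes all
  terms nonnegative.
\<close>
lemma ky_fan_gap: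
  assumes C: "orthonormal_set C" and T: "T \<subseteq> B" "card T = card C"
  shows "(\<Sum>b\<in>T. f b \<bullet> b) - (\<Sum>c\<in>C. f c \<bullet> c) =
      (\<Sum>b\<in>T. (f b \<bullet> b - t) * (1 - b \<bullet> orth_proj (span C) b))
    + (\<Sum>b\<in>B - T. (t - f b \<bullet> b) * (b \<bullet> orth_proj (span C) b))"
proof -
  let ?p = "\<lambda>b. b \<bullet> orth_proj (span C) b"
  have split: "sum g B = sum g T + sum g (B - T)" for g :: "'a \<Rightarrow> real"
    using sum.subset_diff[OF T(1) finite_B, of g] by simp
  have "(\<Sum>b\<in>T. ?p b) + (\<Sum>b\<in>B - T. ?p b) = real (card T)"
    using sum_weights[OF C] T(2) split by simp
  then have "t * (\<Sum>b\<in>T. ?p b) + t * (\<Sum>b\<in>B - T. ?p b) = t * real (card T)"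
    by (metis distrib_left)
  then show ?thesis
    unfolding rayleigh_sum[OF C] split
    by (simp add: algebra_simps sum.distrib sum_subtractf sum_distrib_left)
qed

context
  fixes C T :: "'a set" and t :: real
  assumes C: "orthonormal_set C" and T: "T \<subseteq> B" "card T = card C"
    and above: "\<And>b. b \<in> T \<Longrightarrow> t \<le> f b \<bullet> b"
    and below: "\<And>b. b \<in> B - T \<Longrightarrow> f b \<bullet> b \<le> t"
begin

lemma gap_terms_nonneg:
  shows "b \<in> T \<Longrightarrow> 0 \<le> (f b \<bullet> b - t) * (1 - b \<bullet> orth_proj (span C) b)"
    and "b \<in> B - T \<Longrightarrow> 0 \<le> (t - f b \<bullet> b) * (b \<bullet> orth_proj (span C) b)"
  using above below weight_bounds[OF C] T(1) by (auto intro!: mult_nonneg_nonneg)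

lemma ky_fan_upper: "(\<Sum>c\<in>C. f c \<bullet> c) \<le> (\<Sum>b\<in>T. f b \<bullet> b)"
proof -
  have "0 \<le> (\<Sum>b\<in>T. f b \<bullet> b) - (\<Sum>c\<in>C. f c \<bullet> c)"
    unfolding ky_fan_gap[OF C T, of t]
    by (intro add_nonneg_nonneg sum_nonneg gap_terms_nonneg)
  then show ?thesis by simp
qed

text \<open>
  If the gap is zero, so is each of its terms: the weight is \<open>1\<close> above the threshold, which
  puts \<open>b\<close> in the span, and \<open>0\<close> below it, which makes \<open>b\<close> orthogonal
  to the span.
\<close>
lemma extremal_span:
  assumes eq: "(\<Sum>c\<in>C. f c \<bullet> c) = (\<Sum>b\<in>T. f b \<bullet> b)" and b: "b \<in> B"
  shows "t < f b \<bullet> b \<Longrightarrow> b \<in> span C"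
    and "f b \<bullet> b < t \<Longrightarrow> x \<in> span C \<Longrightarrow> x \<bullet> b = 0"
proof -
  let ?p = "\<lambda>b. b \<bullet> orth_proj (span C) b"
  have fin: "finite T" "finite (B - T)" using finite_B T(1) finite_subset by auto
  have "(\<Sum>b\<in>T. (f b \<bullet> b - t) * (1 - ?p b)) + (\<Sum>b\<in>B - T. (t - f b \<bullet> b) * ?p b) = 0"
    using ky_fan_gap[OF C T, of t] eq by simp
  moreover have "0 \<le> (\<Sum>b\<in>T. (f b \<bullet> b - t) * (1 - ?p b))"
    "0 \<le> (\<Sum>b\<in>B - T. (t - f b \<bullet> b) * ?p b)"
    by (intro sum_nonneg gap_terms_nonneg; assumption)+
  ultimately have "(\<Sum>b\<in>T. (f b \<bullet> b - t) * (1 - ?p b)) = 0"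
    "(\<Sum>b\<in>B - T. (t - f b \<bullet> b) * ?p b) = 0" by linarith+
  then have zero: "\<And>b. b \<in> T \<Longrightarrow> (f b \<bullet> b - t) * (1 - ?p b) = 0"
    "\<And>b. b \<in> B - T \<Longrightarrow> (t - f b \<bullet> b) * ?p b = 0"
    using sum_nonneg_eq_0_iff[OF fin(1), of "\<lambda>b. (f b \<bullet> b - t) * (1 - ?p b)"]
      sum_nonneg_eq_0_iff[OF fin(2), of "\<lambda>b. (t - f b \<bullet> b) * ?p b"] gap_terms_nonneg by blast+
  show "b \<in> span C" if "t < f b \<bullet> b"
  proof (rule orthonormal_one_if_in_span[OF C])
    show "norm b = 1" using b orthonormal by (simp add: orthonormal_set_def)
    have "b \<in> T" using that b below[of b] by force
    then have "?p b = 1" using zero(1)[of b] that by simp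
    then show "(\<Sum>c\<in>C. (b \<bullet> c)\<^sup>2) = 1" by (simp add: inner_orth_proj_span_orthonormal[OF C])
  qed
  show "x \<bullet> b = 0" if "f b \<bullet> b < t" and x: "x \<in> span C"
  proof -
    have "b \<in> B - T" using that b above[of b] by force
    then have "?p b = 0" using zero(2)[of b] that by simp
    then have "\<forall>c\<in>C. b \<bullet> c = 0"
      using orthonormal_set_finite[OF C]
      by (simp add: inner_orth_proj_span_orthonormal[OF C] sum_nonneg_eq_0_iff)
    then have "orthogonal b x"
      by (intro orthogonal_to_span[OF x]) (simp add: orthogonal_def)
    then show ?thesis by (simp add: orthogonal_def inner_commute)
  qed
qed

text \<open>
  In \<open>f x = t x + (\<Sum>b\<in>B. (\<mu>\<^sub>b - t) (x \<bullet> b) b)\<close> the terms below the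
  threshold vanish because \<open>x \<bullet> b = 0\<close>, those at the threshold because
  \<open>\<mu>\<^sub>b = t\<close>, and those above it lie in the span.
\<close>
lemma extremal_invariant:
  assumes eq: "(\<Sum>c\<in>C. f c \<bullet> c) = (\<Sum>b\<in>T. f b \<bullet> b)"
  shows "f ` span C \<subseteq> span C"
proof safe
  fix x assume x: "x \<in> span C"
  have terms: "((f b \<bullet> b - t) * (x \<bullet> b)) *\<^sub>R b \<in> span C" if b: "b \<in> B" for b
    using extremal_span[OF eq b] x
    by (cases "f b \<bullet> b" t rule: linorder_cases) (auto intro: span_scale simp: span_zero)
  then show "f x \<in> span C"
    unfolding shifted_expansion[of x t] by (intro span_add span_scale[OF x] span_sum terms)
qed

text \<open>
  The basis \<open>E\<close> extends the eigenvectors \<open>b\<in>B\<close> above the threshold. Its other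
  elements are orthogonal to these and to all \<open>b\<close> below the threshold, so they have eigenvalue
  \<open>t\<close>; the same is true of the other elements of \<open>T\<close>, and the two sets have equal
  size. The conclusion gives a basis instead of \<open>eigenvalue_mset_on\<close> because eigenbases are
  easily carried over from \<open>-f\<close> to \<open>f\<close>.
\<close>
lemma extremal_eigenbasis:
  assumes eq: "(\<Sum>c\<in>C. f c \<bullet> c) = (\<Sum>b\<in>T. f b \<bullet> b)"
  shows "\<exists>E. orthonormal_set E \<and> eigenvectors f E \<and> span E = span C \<and>
    image_mset (\<lambda>c. f c \<bullet> c) (mset_set E) = image_mset (\<lambda>b. f b \<bullet> b) (mset_set T)"
proof -
  let ?D = "{b\<in>B. t < f b \<bullet> b}"
  have DT: "?D \<subseteq> T" using below by force
  have "orthonormal_set ?D" by (rule orthonormal_set_subset[OF orthonormal]) auto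
  moreover have "eigenvectors f ?D" using eigenvectors by (auto simp: eigenvectors_def)
  moreover have "?D \<subseteq> span C" using extremal_span(1)[OF eq] by auto
  ultimately obtain E where E: "?D \<subseteq> E" "orthonormal_set E" "eigenvectors f E" "span E = span C"
    using orthonormal_eigenvectors_extend[OF lin subspace_span extremal_invariant[OF eq] self_adjoint]
    by blast
  have rest: "f e \<bullet> e = t" if e: "e \<in> E - ?D" for e
  proof -
    have eC: "e \<in> span C" using e E(4) span_base by blast
    have "(f b \<bullet> b - t) * (e \<bullet> b) = 0" if b: "b \<in> B" for b
    proof (cases "f b \<bullet> b" t rule: linorder_cases)
      case less
      then show ?thesis using extremal_span(2)[OF eq b less eC] by simp
    next
      case greater
      then have "b \<in> E" "e \<noteq> b" using E(1) b e by auto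
      then show ?thesis using orthonormal_set_inner[OF E(2), of e b] e by simp
    qed simp
    then have "f e = t *\<^sub>R e" unfolding shifted_expansion[of e t] by (simp add: sum.neutral del: mult_eq_0_iff)
    then show ?thesis using orthonormal_set_inner[OF E(2), of e e] e by simp
  qed
  have fin: "finite E" "finite T"
    using orthonormal_set_finite[OF E(2)] finite_subset[OF T(1) finite_B] by auto
  have card: "card E = card T"
    using T(2) orthonormal_set_card[OF C] orthonormal_set_card[OF E(2)] E(4) by simp
  \<comment> \<open>Apply this to both \<open>E\<close> and \<open>T\<close>, which have the same cardinality.\<close>
  have decomp: "image_mset (\<lambda>c. f c \<bullet> c) (mset_set X) =
      image_mset (\<lambda>c. f c \<bullet> c) (mset_set ?D) + replicate_mset (card X - card ?D) t"
    if "finite X" "?D \<subseteq> X" "\<And>x. x \<in> X - ?D \<Longrightarrow> f x \<bullet> x = t" for X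
  proof -
    have "finite ?D" by (rule finite_subset[OF that(2,1)])
    have "mset_set (?D \<union> (X - ?D)) = mset_set ?D + mset_set (X - ?D)"
      using \<open>finite ?D\<close> \<open>finite X\<close> by (intro mset_set_Union) auto
    moreover have "?D \<union> (X - ?D) = X" using that(2) by blast
    moreover have "image_mset (\<lambda>c. f c \<bullet> c) (mset_set (X - ?D)) = image_mset (\<lambda>_. t) (mset_set (X - ?D))"
      by (rule image_mset_cong, rule that(3)) (use \<open>finite X\<close> in simp)
    ultimately show ?thesis
      using card_Diff_subset[OF \<open>finite ?D\<close> that(2)] by (simp only: image_mset_union image_mset_const_eq size_mset_set)
  qed
  have "f b \<bullet> b = t" if "b \<in> T - ?D" for b
    using that above[of b] T(1) by force
  then have "image_mset (\<lambda>c. f c \<bullet> c) (mset_set E) = image_mset (\<lambda>b. f b \<bullet> b) (mset_set T)"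
    using decomp[OF fin(1) E(1) rest] decomp[OF fin(2) DT] card by simp
  with E show ?thesis by blast
qed

end

text \<open>
  The trace on an invariant subspace is the sum of its eigenvalues, computed in an eigenbasis of that
  subspace.
\<close>
lemma rayleigh_sum_eqI:
  assumes "orthonormal_set C" "f ` span C \<subseteq> span C"
    and "eigenvalue_mset_on f (span C) = image_mset (\<lambda>b. f b \<bullet> b) (mset_set T)"
  shows "(\<Sum>c\<in>C. f c \<bullet> c) = (\<Sum>b\<in>T. f b \<bullet> b)"
proof -
  obtain E where E: "orthonormal_set E" "eigenvectors f E" "span E = span C"
    using orthonormal_eigenvectors_extend[OF lin subspace_span assms(2) self_adjoint, of "{}"]
    by (auto simp: orthonormal_set_def eigenvectors_def)
  have "(\<Sum>c\<in>C. f c \<bullet> c) = (\<Sum>c\<in>E. f c \<bullet> c)"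
    by (simp add: rayleigh_sum assms(1) E)
  also have "\<dots> = (\<Sum>b\<in>T. f b \<bullet> b)"
    using assms(3) eigenvalue_mset_on_eigenbasis[OF lin E(1,2)] E(3)
    by (simp add: sum_unfold_sum_mset)
  finally show ?thesis .
qed

text \<open>
  The threshold \<open>t\<close> says that \<open>T\<close> carries the largest eigenvalues. It leaves open
  which eigenvectors are chosen when \<open>t\<close> itself is a multiple eigenvalue, but their eigenvalues
  are the same.
\<close>
theorem ky_fan_max:
  assumes C: "orthonormal_set C" and T: "T \<subseteq> B" "card T = card C"
    and above: "\<And>b. b \<in> T \<Longrightarrow> t \<le> f b \<bullet> b"
    and below: "\<And>b. b \<in> B - T \<Longrightarrow> f b \<bullet> b \<le> t"
  shows "(\<Sum>c\<in>C. f c \<bullet> c) \<le> (\<Sum>b\<in>T. f b \<bullet> b)"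
    and "(\<Sum>c\<in>C. f c \<bullet> c) = (\<Sum>b\<in>T. f b \<bullet> b) \<longleftrightarrow>
      f ` span C \<subseteq> span C \<and>
      eigenvalue_mset_on f (span C) = image_mset (\<lambda>b. f b \<bullet> b) (mset_set T)"
proof -
  show "(\<Sum>c\<in>C. f c \<bullet> c) \<le> (\<Sum>b\<in>T. f b \<bullet> b)"
    by (rule ky_fan_upper[OF C T above below])
  show "(\<Sum>c\<in>C. f c \<bullet> c) = (\<Sum>b\<in>T. f b \<bullet> b) \<longleftrightarrow> f ` span C \<subseteq> span C \<and>
      eigenvalue_mset_on f (span C) = image_mset (\<lambda>b. f b \<bullet> b) (mset_set T)" (is "?l \<longleftrightarrow> ?r")
  proof
    assume ?l
    then show ?r
      using extremal_invariant[OF C T above below] extremal_eigenbasis[OF C T above below]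
        eigenvalue_mset_on_eigenbasis[OF lin] by metis
  qed (use rayleigh_sum_eqI[OF C] in blast)
qed

theorem ky_fan_min:
  assumes C: "orthonormal_set C" and T: "T \<subseteq> B" "card T = card C"
    and below: "\<And>b. b \<in> T \<Longrightarrow> f b \<bullet> b \<le> t"
    and above: "\<And>b. b \<in> B - T \<Longrightarrow> t \<le> f b \<bullet> b"
  shows "(\<Sum>b\<in>T. f b \<bullet> b) \<le> (\<Sum>c\<in>C. f c \<bullet> c)"
    and "(\<Sum>c\<in>C. f c \<bullet> c) = (\<Sum>b\<in>T. f b \<bullet> b) \<longleftrightarrow>
      f ` span C \<subseteq> span C \<and>
      eigenvalue_mset_on f (span C) = image_mset (\<lambda>b. f b \<bullet> b) (mset_set T)"
proof -
  interpret neg: orthonormal_eigenbasis "\<lambda>x. - f x" B by (rule negated)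
  have bounds: "\<And>b. b \<in> T \<Longrightarrow> - t \<le> - f b \<bullet> b" "\<And>b. b \<in> B - T \<Longrightarrow> - f b \<bullet> b \<le> - t"
    using above below by simp_all
  show "(\<Sum>b\<in>T. f b \<bullet> b) \<le> (\<Sum>c\<in>C. f c \<bullet> c)"
    using neg.ky_fan_upper[OF C T bounds] by (simp add: sum_negf)
  show "(\<Sum>c\<in>C. f c \<bullet> c) = (\<Sum>b\<in>T. f b \<bullet> b) \<longleftrightarrow> f ` span C \<subseteq> span C \<and>
      eigenvalue_mset_on f (span C) = image_mset (\<lambda>b. f b \<bullet> b) (mset_set T)" (is "?l \<longleftrightarrow> ?r")
  proof
    assume ?l
    then have eq: "(\<Sum>c\<in>C. - f c \<bullet> c) = (\<Sum>b\<in>T. - f b \<bullet> b)" by (simp add: sum_negf)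
    obtain E where E: "orthonormal_set E" "eigenvectors (\<lambda>x. - f x) E" "span E = span C"
      "image_mset (\<lambda>c. - f c \<bullet> c) (mset_set E) = image_mset (\<lambda>b. - f b \<bullet> b) (mset_set T)"
      using neg.extremal_eigenbasis[OF C T bounds eq] by blast
    have "eigenvectors f E"
      unfolding eigenvectors_def
    proof
      fix e assume "e \<in> E"
      then have "- f e = (- f e \<bullet> e) *\<^sub>R e" using E(2) by (simp add: eigenvectors_def)
      then have "- f e = - ((f e \<bullet> e) *\<^sub>R e)" by simp
      then show "f e = (f e \<bullet> e) *\<^sub>R e" by (simp only: neg_equal_iff_equal)
    qed
    then have "eigenvalue_mset_on f (span C) = image_mset (\<lambda>c. f c \<bullet> c) (mset_set E)"
      using eigenvalue_mset_on_eigenbasis[OF lin E(1)] E(3) by simp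
    also have "\<dots> = image_mset (\<lambda>b. f b \<bullet> b) (mset_set T)"
      using arg_cong[OF E(4), of "image_mset uminus"]
      by (simp add: image_mset.compositionality comp_def)
    moreover have "f ` span C \<subseteq> span C"
    proof safe
      fix x assume "x \<in> span C"
      then have "- f x \<in> span C" using neg.extremal_invariant[OF C T bounds eq] by blast
      then show "f x \<in> span C" using span_neg by fastforce
    qed
    ultimately show ?r by simp
  qed (use rayleigh_sum_eqI[OF C] in blast)
qed

end

section \<open>The edge matrix of a simplex\<close>

text \<open>
  Each summand \<open>e e\<^sup>T\<close> maps \<open>x\<close> to \<open>(x \<bullet> e) e\<close>.
\<close>
lemma edge_matrix_mult:
  fixes A :: "'n::finite \<Rightarrow> real ^ 'n"
  shows "edge_matrix A *v x = (\<Sum>i\<in>UNIV. (x \<bullet> unit_edge A i) *\<^sub>R unit_edge A i)"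
proof -
  have "((columnvector e :: real ^ 1 ^ 'n) ** rowvector e) *v x = (x \<bullet> e) *\<^sub>R e"
    for e x :: "real ^ 'n"
    by (simp add: vec_eq_iff matrix_vector_mult_def matrix_matrix_mult_def columnvector_def
        rowvector_def inner_vec_def sum_distrib_left mult_ac)
  moreover have "(\<Sum>i\<in>I. N i) *v x = (\<Sum>i\<in>I. N i *v x)"
    if "finite I" for N :: "'n \<Rightarrow> real ^ 'n ^ 'n" and I
    using that by induction (simp_all add: matrix_vector_mult_add_rdistrib)
  ultimately show ?thesis unfolding edge_matrix_def by simp
qed

lemma edge_matrix_self_adjoint: "(edge_matrix A *v x) \<bullet> y = x \<bullet> (edge_matrix A *v y)"
  by (simp add: edge_matrix_mult inner_sum_left inner_sum_right inner_commute mult.commute)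

text \<open>
  Cyclicity of the trace, applied to each summand of \<open>Q = (\<Sum>c\<in>C. c c\<^sup>T)\<close>.
\<close>
lemma trace_orth_proj_mult:
  fixes N :: "real ^ 'n ^ 'n"
  assumes "orthonormal_set C"
  shows "trace (matrix (orth_proj (span C)) ** N) = (\<Sum>c\<in>C. (N *v c) \<bullet> c)"
proof -
  have "trace (matrix (orth_proj (span C)) ** N) =
      (\<Sum>i\<in>UNIV. \<Sum>j\<in>UNIV. \<Sum>c\<in>C. c $ j * c $ i * N $ j $ i)"
    by (simp add: trace_def matrix_matrix_mult_def matrix_def
        orth_proj_span_orthonormal[OF assms] inner_axis' sum_distrib_right)
  also have "\<dots> = (\<Sum>c\<in>C. \<Sum>j\<in>UNIV. \<Sum>i\<in>UNIV. c $ j * c $ i * N $ j $ i)"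
    by (subst sum.swap, subst sum.swap, rule sum.swap)
  also have "\<dots> = (\<Sum>c\<in>C. (N *v c) \<bullet> c)"
    by (simp add: inner_vec_def matrix_vector_mult_def sum_distrib_right sum_distrib_left mult_ac)
  finally show ?thesis .
qed

text \<open>
  Expand the square with \<open>q = Q A\<^sub>i\<close>: since \<open>A\<^sub>i - q\<close> is orthogonal to
  \<open>q\<close>, both \<open>A\<^sub>i \<bullet> q\<close> and \<open>q \<bullet> q\<close> are the sum
  of the squares \<open>(A\<^sub>i \<bullet> c)\<^sup>2\<close>, which gives the factor
  \<open>1 - 2 l\<close>. Summing over \<open>i\<close> first turns the squares into Rayleigh values of the
  edge matrix.
\<close>
lemma ratio_sum_eq_trace:
  fixes A :: "'n::finite \<Rightarrow> real ^ 'n"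
  assumes C: "orthonormal_set C" and nz: "0 \<notin> range A"
  shows "ratio_sum A (span C) l = real CARD('n) * l\<^sup>2
    + (1 - 2 * l) * trace (matrix (orth_proj (span C)) ** edge_matrix A)"
proof -
  have "(dist (l *\<^sub>R A i) (orth_proj (span C) (A i)))\<^sup>2 / (dist 0 (A i))\<^sup>2
      = l\<^sup>2 + (1 - 2 * l) * (\<Sum>c\<in>C. (unit_edge A i \<bullet> c)\<^sup>2)" for i
  proof -
    let ?q = "\<Sum>c\<in>C. (A i \<bullet> c) *\<^sub>R c"
    let ?r = "norm (A i)"
    have r: "?r \<noteq> 0" using nz by (metis norm_eq_zero rangeI)
    have q: "?q \<in> span C" by (intro span_sum span_scale span_base)
    have Aq: "A i \<bullet> ?q = (\<Sum>c\<in>C. (A i \<bullet> c)\<^sup>2)"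
      by (simp add: inner_sum_right power2_eq_square)
    have qq: "?q \<bullet> ?q = A i \<bullet> ?q"
      using orthonormal_residual[OF C q, of "A i"] by (simp add: inner_diff_left)
    have "(dist (l *\<^sub>R A i) ?q)\<^sup>2 = (l *\<^sub>R A i - ?q) \<bullet> (l *\<^sub>R A i - ?q)"
      by (simp add: dist_norm power2_norm_eq_inner)
    also have "\<dots> = l\<^sup>2 * (A i \<bullet> A i) - 2 * l * (A i \<bullet> ?q) + ?q \<bullet> ?q"
      by (simp add: inner_diff_left inner_diff_right inner_commute power2_eq_square)
    also have "\<dots> = l\<^sup>2 * ?r\<^sup>2 + (1 - 2 * l) * (\<Sum>c\<in>C. (A i \<bullet> c)\<^sup>2)"
      unfolding qq Aq by (simp add: power2_norm_eq_inner algebra_simps)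
    also have "(\<Sum>c\<in>C. (A i \<bullet> c)\<^sup>2) = ?r\<^sup>2 * (\<Sum>c\<in>C. (unit_edge A i \<bullet> c)\<^sup>2)"
      using r by (simp add: unit_edge_def power_mult_distrib sum_distrib_left field_simps)
    finally show ?thesis
      using r by (simp add: orth_proj_span_orthonormal[OF C] field_simps)
  qed
  then have "ratio_sum A (span C) l = real CARD('n) * l\<^sup>2
      + (1 - 2 * l) * (\<Sum>i\<in>UNIV. \<Sum>c\<in>C. (unit_edge A i \<bullet> c)\<^sup>2)"
    unfolding ratio_sum_def by (simp add: sum.distrib sum_distrib_left)
  also have "(\<Sum>i\<in>UNIV. \<Sum>c\<in>C. (unit_edge A i \<bullet> c)\<^sup>2) = (\<Sum>c\<in>C. (edge_matrix A *v c) \<bullet> c)"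
    by (subst sum.swap)
       (simp add: edge_matrix_mult inner_sum_left power2_eq_square inner_commute[of "unit_edge A _"])
  also have "\<dots> = trace (matrix (orth_proj (span C)) ** edge_matrix A)"
    by (rule trace_orth_proj_mult[OF C, symmetric])
  finally show ?thesis .
qed

text \<open>
  Sorting the eigenbasis by Rayleigh value and reversing yields the list from which the ordered eigenvalues
  are read.
\<close>
lemma ordered_eigenvalue_enumeration:
  fixes M :: "real ^ 'n ^ 'n"
  assumes "orthonormal_eigenbasis ((*v) M) B"
  obtains b where "bij_betw b {1..CARD('n)} B"
    and "\<And>i. i \<in> {1..CARD('n)} \<Longrightarrow> ordered_eigenvalue M i = (M *v b i) \<bullet> b i"
    and "\<And>i j. 1 \<le> i \<Longrightarrow> i \<le> j \<Longrightarrow> j \<le> CARD('n) \<Longrightarrow>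
      ordered_eigenvalue M j \<le> ordered_eigenvalue M i"
proof -
  interpret orthonormal_eigenbasis "(*v) M" B by (rule assms)
  let ?\<mu> = "\<lambda>b. (M *v b) \<bullet> b"
  obtain xs where xs: "set xs = B" "distinct xs" using finite_distinct_list[OF finite_B] by blast
  define ys where "ys = rev (sort_key ?\<mu> xs)"
  have len: "length ys = CARD('n)"
    using orthonormal_set_card[OF orthonormal] span_B xs
    by (simp add: ys_def flip: distinct_card)
  have "eigenvalue_mset_on ((*v) M) UNIV = mset (map ?\<mu> (sort_key ?\<mu> xs))"
    using eigenvalue_mset_on_eigenbasis[OF lin orthonormal eigenvectors] xs span_B
    by (auto simp: mset_set_set)
  moreover have "sort (map ?\<mu> (sort_key ?\<mu> xs)) = map ?\<mu> (sort_key ?\<mu> xs)"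
    by (rule sorted_sort_id) simp
  ultimately have list: "rev (sorted_list_of_multiset (eigenvalue_mset_on ((*v) M) UNIV)) = map ?\<mu> ys"
    by (simp only: sorted_list_of_multiset_mset ys_def rev_map)
  have desc: "map ?\<mu> ys ! j \<le> map ?\<mu> ys ! i" if "i \<le> j" "j < length ys" for i j
    using sorted_rev_nth_mono[of "map ?\<mu> ys" i j] that by (simp add: ys_def flip: rev_map)
  \<comment> \<open>Eigenvalues are numbered from one, list positions from zero.\<close>
  define b where "b i = ys ! (i - 1)" for i
  show thesis
  proof
    have "bij_betw (\<lambda>i. i - 1) {1..CARD('n)} {..<CARD('n)}"
      by (rule bij_betw_byWitness[where f' = Suc]) auto
    moreover have "bij_betw ((!) ys) {..<CARD('n)} B"
      using bij_betw_nth[of ys "{..<CARD('n)}" B] xs len by (simp add: ys_def)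
    ultimately show "bij_betw b {1..CARD('n)} B"
      using bij_betw_trans unfolding b_def comp_def by blast
    show "ordered_eigenvalue M i = ?\<mu> (b i)" if "i \<in> {1..CARD('n)}" for i
      unfolding ordered_eigenvalue_def list b_def using that len by (subst nth_map) auto
    show "ordered_eigenvalue M j \<le> ordered_eigenvalue M i"
      if "1 \<le> i" "i \<le> j" "j \<le> CARD('n)" for i j
      unfolding ordered_eigenvalue_def list using that len by (intro desc) auto
  qed
qed

theorem theorem4p1:
  fixes A :: "'n::finite \<Rightarrow> real ^ 'n" and k :: nat
  assumes "inj A" and "0 \<notin> range A" and "\<not> affine_dependent (insert 0 (range A))"
    and "1 \<le> k" and "k \<le> CARD('n) - 1"
  defines "M \<equiv> edge_matrix A"
  shows "(\<forall>L. subspace L \<and> dim L = k \<longrightarrow>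
       sigma_minus M k \<le> trace (matrix (orth_proj L) ** M)
     \<and> trace (matrix (orth_proj L) ** M) \<le> sigma_plus M k
     \<and> (\<forall>l::real.
          (l < 1/2 \<longrightarrow>
             real CARD('n) * l\<^sup>2 + (1 - 2 * l) * sigma_minus M k \<le> ratio_sum A L l
           \<and> ratio_sum A L l \<le> real CARD('n) * l\<^sup>2 + (1 - 2 * l) * sigma_plus M k)
        \<and> (l = 1/2 \<longrightarrow> ratio_sum A L l = real CARD('n) / 4)
        \<and> (l > 1/2 \<longrightarrow>
             real CARD('n) * l\<^sup>2 + (1 - 2 * l) * sigma_plus M k \<le> ratio_sum A L l
           \<and> ratio_sum A L l \<le> real CARD('n) * l\<^sup>2 + (1 - 2 * l) * sigma_minus M k))
     \<and> (trace (matrix (orth_proj L) ** M) = sigma_plus M k \<longleftrightarrow>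
          (*v) M ` L \<subseteq> L
        \<and> eigenvalue_mset_on ((*v) M) L =
            image_mset (ordered_eigenvalue M) (mset_set {1..k}))
     \<and> (trace (matrix (orth_proj L) ** M) = sigma_minus M k \<longleftrightarrow>
          (*v) M ` L \<subseteq> L
        \<and> eigenvalue_mset_on ((*v) M) L =
            image_mset (ordered_eigenvalue M) (mset_set {CARD('n) - k + 1..CARD('n)})))
   \<and> (\<exists>L. subspace L \<and> dim L = k \<and> trace (matrix (orth_proj L) ** M) = sigma_plus M k)
   \<and> (\<exists>L. subspace L \<and> dim L = k \<and> trace (matrix (orth_proj L) ** M) = sigma_minus M k)"
proof -
  let ?n = "CARD('n)"
  let ?\<mu> = "\<lambda>b. (M *v b) \<bullet> b"
  have lin: "linear ((*v) M)" by simp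
  have sym: "(M *v x) \<bullet> y = x \<bullet> (M *v y)" for x y
    unfolding M_def by (rule edge_matrix_self_adjoint)
  obtain B where B: "orthonormal_set B" "eigenvectors ((*v) M) B" "span B = UNIV"
    using orthonormal_eigenvectors_extend[OF lin subspace_UNIV subset_UNIV sym, of "{}"]
    by (auto simp: orthonormal_set_def eigenvectors_def)
  interpret orthonormal_eigenbasis "(*v) M" B
    by (rule orthonormal_eigenbasis.intro[OF lin sym B])
  obtain b where b: "bij_betw b {1..?n} B"
    and val: "\<And>i. i \<in> {1..?n} \<Longrightarrow> ordered_eigenvalue M i = ?\<mu> (b i)"
    and desc: "\<And>i j. 1 \<le> i \<Longrightarrow> i \<le> j \<Longrightarrow> j \<le> ?n \<Longrightarrow>
      ordered_eigenvalue M j \<le> ordered_eigenvalue M i"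
    by (rule ordered_eigenvalue_enumeration[OF orthonormal_eigenbasis_axioms]) (rule that)
  let ?I = "{1..k}" and ?J = "{?n - k + 1..?n}"
  have kn: "1 \<le> k" "k < ?n" using assms(4,5) by auto
  then have sub: "?I \<subseteq> {1..?n}" "?J \<subseteq> {1..?n}" by auto
  have inj: "inj_on b {1..?n}" and img: "b ` {1..?n} = B" using b by (auto simp: bij_betw_def)
  \<comment> \<open>The two eigenvalue sums run over indices, Ky Fan's principle over eigenvectors.\<close>
  have transport: "sum ?\<mu> (b ` X) = sum (ordered_eigenvalue M) X"
    "image_mset ?\<mu> (mset_set (b ` X)) = image_mset (ordered_eigenvalue M) (mset_set X)"
    "card (b ` X) = card X" "b ` X \<subseteq> B"
    if X: "X \<subseteq> {1..?n}" for X
  proof -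
    have injX: "inj_on b X" using inj X by (rule inj_on_subset)
    have eq: "ordered_eigenvalue M i = ?\<mu> (b i)" if "i \<in> X" for i using val X that by auto
    show "sum ?\<mu> (b ` X) = sum (ordered_eigenvalue M) X"
      by (simp add: sum.reindex[OF injX] eq)
    show "card (b ` X) = card X" by (rule card_image[OF injX])
    show "b ` X \<subseteq> B" using X img by auto
    have "image_mset ?\<mu> (mset_set (b ` X)) = image_mset (\<lambda>i. ?\<mu> (b i)) (mset_set X)"
      by (simp add: image_mset.compositionality comp_def flip: image_mset_mset_set[OF injX])
    also have "\<dots> = image_mset (ordered_eigenvalue M) (mset_set X)"
      using eq finite_subset[OF X] by (intro image_mset_cong) simp
    finally show "image_mset ?\<mu> (mset_set (b ` X)) = image_mset (ordered_eigenvalue M) (mset_set X)" .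
  qed
  have plus: "sigma_plus M k = sum ?\<mu> (b ` ?I)" and minus: "sigma_minus M k = sum ?\<mu> (b ` ?J)"
    using transport(1)[OF sub(1)] transport(1)[OF sub(2)] by (simp_all add: sigma_plus_def sigma_minus_def)
  have cards: "card (b ` ?I) = k" "card (b ` ?J) = k"
    using transport(3)[OF sub(1)] transport(3)[OF sub(2)] kn by simp_all
  have compl: "B - b ` X = b ` ({1..?n} - X)" if "X \<subseteq> {1..?n}" for X
    using inj_on_image_set_diff[OF inj _ that, of "{1..?n}"] img by simp
  \<comment> \<open>The thresholds: the smallest of the first \<open>k\<close> eigenvalues and the largest of the last \<open>k\<close>.\<close>
  define s where "s = ordered_eigenvalue M k"
  define t where "t = ordered_eigenvalue M (?n - k + 1)"
  have I: "v \<in> b ` ?I \<Longrightarrow> s \<le> ?\<mu> v" "v \<in> B - b ` ?I \<Longrightarrow> ?\<mu> v \<le> s" for v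
    unfolding compl[OF sub(1)] s_def using kn by (auto simp flip: val intro!: desc)
  have J: "v \<in> b ` ?J \<Longrightarrow> ?\<mu> v \<le> t" "v \<in> B - b ` ?J \<Longrightarrow> t \<le> ?\<mu> v" for v
    unfolding compl[OF sub(2)] t_def using kn by (auto simp flip: val intro!: desc)
  have bounds: "sigma_minus M k \<le> trace (matrix (orth_proj L) ** M)"
      "trace (matrix (orth_proj L) ** M) \<le> sigma_plus M k"
    and ratio: "ratio_sum A L l =
      real ?n * l\<^sup>2 + (1 - 2 * l) * trace (matrix (orth_proj L) ** M)"
    and plus_iff: "trace (matrix (orth_proj L) ** M) = sigma_plus M k \<longleftrightarrow> (*v) M ` L \<subseteq> L
        \<and> eigenvalue_mset_on ((*v) M) L = image_mset (ordered_eigenvalue M) (mset_set ?I)"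
    and minus_iff: "trace (matrix (orth_proj L) ** M) = sigma_minus M k \<longleftrightarrow> (*v) M ` L \<subseteq> L
        \<and> eigenvalue_mset_on ((*v) M) L = image_mset (ordered_eigenvalue M) (mset_set ?J)"
    if V: "subspace L \<and> dim L = k" for L l
  proof -
    have sL: "subspace L" and dL: "dim L = k" using V by auto
    obtain C where C: "orthonormal_set C" "card C = k" "span C = L"
      using orthonormal_basis_subspace[OF sL] dL by (metis orthonormal_set_def)
    have tr: "trace (matrix (orth_proj L) ** M) = (\<Sum>c\<in>C. ?\<mu> c)"
      using trace_orth_proj_mult[OF C(1)] C(3) by simp
    have cardC: "card (b ` ?I) = card C" "card (b ` ?J) = card C" using cards C(2) by simp_all
    note max = ky_fan_max[OF C(1) transport(4)[OF sub(1)] cardC(1) I]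
    note min = ky_fan_min[OF C(1) transport(4)[OF sub(2)] cardC(2) J]
    show "sigma_minus M k \<le> trace (matrix (orth_proj L) ** M)"
      unfolding tr minus by (rule min(1))
    show "trace (matrix (orth_proj L) ** M) \<le> sigma_plus M k"
      unfolding tr plus by (rule max(1))
    show "ratio_sum A L l = real ?n * l\<^sup>2 + (1 - 2 * l) * trace (matrix (orth_proj L) ** M)"
      using ratio_sum_eq_trace[OF C(1) assms(2)] unfolding C(3) M_def .
    show "trace (matrix (orth_proj L) ** M) = sigma_plus M k \<longleftrightarrow> (*v) M ` L \<subseteq> L
        \<and> eigenvalue_mset_on ((*v) M) L = image_mset (ordered_eigenvalue M) (mset_set ?I)"
      using max(2) unfolding tr plus C(3) transport(2)[OF sub(1)] .
    show "trace (matrix (orth_proj L) ** M) = sigma_minus M k \<longleftrightarrow> (*v) M ` L \<subseteq> L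
        \<and> eigenvalue_mset_on ((*v) M) L = image_mset (ordered_eigenvalue M) (mset_set ?J)"
      using min(2) unfolding tr minus C(3) transport(2)[OF sub(2)] .
  qed
  have attained: "\<exists>L. subspace L \<and> dim L = k \<and> trace (matrix (orth_proj L) ** M) = sum ?\<mu> (b ` X)"
    if X: "X \<subseteq> {1..?n}" "card (b ` X) = k" for X
  proof -
    have on: "orthonormal_set (b ` X)"
      using transport(4)[OF X(1)] by (rule orthonormal_set_subset[OF B(1)])
    have "dim (span (b ` X)) = k"
      using orthonormal_set_card[OF on] X(2) by simp
    then show ?thesis
      using trace_orth_proj_mult[OF on, of M] subspace_span by blast
  qed
  have affine: "l < 1/2 \<Longrightarrow> c + (1 - 2 * l) * x \<le> c + (1 - 2 * l) * y"
    "1/2 < l \<Longrightarrow> c + (1 - 2 * l) * y \<le> c + (1 - 2 * l) * x" if "x \<le> y" for c l x y :: real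
    using that by (auto intro: mult_left_mono mult_left_mono_neg)
  show ?thesis
  proof (intro conjI allI impI)
    show "\<exists>L. subspace L \<and> dim L = k \<and> trace (matrix (orth_proj L) ** M) = sigma_plus M k"
      unfolding plus by (rule attained[OF sub(1) cards(1)])
    show "\<exists>L. subspace L \<and> dim L = k \<and> trace (matrix (orth_proj L) ** M) = sigma_minus M k"
      unfolding minus by (rule attained[OF sub(2) cards(2)])
    fix L :: "(real ^ 'n) set" and l :: real
    assume V: "subspace L \<and> dim L = k"
    note tr_bounds = bounds[OF V]
    show "sigma_minus M k \<le> trace (matrix (orth_proj L) ** M)"
      and "trace (matrix (orth_proj L) ** M) \<le> sigma_plus M k"
      by (rule tr_bounds)+
    show "trace (matrix (orth_proj L) ** M) = sigma_plus M k \<longleftrightarrow> (*v) M ` L \<subseteq> L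
        \<and> eigenvalue_mset_on ((*v) M) L = image_mset (ordered_eigenvalue M) (mset_set ?I)"
      by (rule plus_iff[OF V])
    show "trace (matrix (orth_proj L) ** M) = sigma_minus M k \<longleftrightarrow> (*v) M ` L \<subseteq> L
        \<and> eigenvalue_mset_on ((*v) M) L = image_mset (ordered_eigenvalue M) (mset_set ?J)"
      by (rule minus_iff[OF V])
    show "ratio_sum A L l = real ?n / 4" if "l = 1/2"
      unfolding ratio[OF V] that by (simp add: power2_eq_square)
    show "real ?n * l\<^sup>2 + (1 - 2 * l) * sigma_minus M k \<le> ratio_sum A L l"
      and "ratio_sum A L l \<le> real ?n * l\<^sup>2 + (1 - 2 * l) * sigma_plus M k" if "l < 1/2"
      unfolding ratio[OF V] using that tr_bounds by (blast intro: affine(1))+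
    show "real ?n * l\<^sup>2 + (1 - 2 * l) * sigma_plus M k \<le> ratio_sum A L l"
      and "ratio_sum A L l \<le> real ?n * l\<^sup>2 + (1 - 2 * l) * sigma_minus M k" if "1/2 < l"
      unfolding ratio[OF V] using that tr_bounds by (blast intro: affine(2))+
  qed
qed

end
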